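(* Let $G$ be a finite group acting on a finite nonempty set $X$, and let $z:=|X/G|$ be the number of $G$-orbits. Let $Q$ be the dual Burnside kernel on $G^*$. Then the probability measure $$\pi_Q(g)=\frac{|X_g|}{|G|\,z},\qquad g\in G^*,$$ is stationary and reversible for $Q$, i.e. $\pi_Q Q=\pi_Q$ and $\pi_Q(g)Q(g,h)=\pi_Q(h)Q(h,g)$ for all $g,h\in G^*$. Moreover, $Q$ is irreducible and aperiodic; hence $\pi_Q$ is the unique stationary distribution of $Q$.
   Context: For $g\in G$ and $x\in X$ write $X_g:=\{x\in X: g\cdot x=x\}$, $G_x:=\{g\in G: g\cdot x=x\}$, and $G^*:=\{g\in G: X_g\neq\varnothing\}$. The dual Burnside process is the Markov chain on $G^*$ with transition kernel $$Q(g,h)=\frac1{|X_g|}\sum_{x\in X_g\cap X_h}\frac1{|G_x|}\qquad(g,h\in G^* );$$ equivalently, from $g$ sample $x$ uniformly from $X_g$, then $h$ uniformly from $G_x$, and move to $h$. *)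

theory Defs
  imports Complex_Main "HOL-Algebra.Group_Action"
begin

section \<open>Markov chains on a finite state space\<close>

text \<open>
  A kernel on a finite state space \<open>S\<close> is a function \<open>Q :: 'a \<Rightarrow> 'a \<Rightarrow> real\<close>, a distribution a
  function \<open>'a \<Rightarrow> real\<close>.  Only their values on \<open>S\<close> are meaningful.
\<close>

definition prob_distribution_on :: "'a set \<Rightarrow> ('a \<Rightarrow> real) \<Rightarrow> bool"
  where "prob_distribution_on S \<mu> \<longleftrightarrow> (\<forall>g\<in>S. 0 \<le> \<mu> g) \<and> (\<Sum>g\<in>S. \<mu> g) = 1"

definition markov_kernel :: "'a set \<Rightarrow> ('a \<Rightarrow> 'a \<Rightarrow> real) \<Rightarrow> bool"
  where "markov_kernel S Q \<longleftrightarrow> (\<forall>g\<in>S. prob_distribution_on S (Q g))"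

fun kernel_power :: "'a set \<Rightarrow> ('a \<Rightarrow> 'a \<Rightarrow> real) \<Rightarrow> nat \<Rightarrow> 'a \<Rightarrow> 'a \<Rightarrow> real" where
  "kernel_power S Q 0 g h = (if g = h then 1 else 0)"
| "kernel_power S Q (Suc n) g h = (\<Sum>k\<in>S. kernel_power S Q n g k * Q k h)"

definition stationary :: "'a set \<Rightarrow> ('a \<Rightarrow> 'a \<Rightarrow> real) \<Rightarrow> ('a \<Rightarrow> real) \<Rightarrow> bool"
  where "stationary S Q \<mu> \<longleftrightarrow> (\<forall>h\<in>S. (\<Sum>g\<in>S. \<mu> g * Q g h) = \<mu> h)"

definition reversible :: "'a set \<Rightarrow> ('a \<Rightarrow> 'a \<Rightarrow> real) \<Rightarrow> ('a \<Rightarrow> real) \<Rightarrow> bool"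
  where "reversible S Q \<mu> \<longleftrightarrow> (\<forall>g\<in>S. \<forall>h\<in>S. \<mu> g * Q g h = \<mu> h * Q h g)"

definition irreducible_kernel :: "'a set \<Rightarrow> ('a \<Rightarrow> 'a \<Rightarrow> real) \<Rightarrow> bool"
  where "irreducible_kernel S Q \<longleftrightarrow> (\<forall>g\<in>S. \<forall>h\<in>S. \<exists>n\<ge>1. kernel_power S Q n g h > 0)"

definition period :: "'a set \<Rightarrow> ('a \<Rightarrow> 'a \<Rightarrow> real) \<Rightarrow> 'a \<Rightarrow> nat"
  where "period S Q g = Gcd {n. n \<ge> 1 \<and> kernel_power S Q n g g > 0}"

definition aperiodic_kernel :: "'a set \<Rightarrow> ('a \<Rightarrow> 'a \<Rightarrow> real) \<Rightarrow> bool"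
  where "aperiodic_kernel S Q \<longleftrightarrow> (\<forall>g\<in>S. period S Q g = 1)"


section \<open>The dual Burnside process\<close>

text \<open>
  For an action \<open>\<phi>\<close> of \<open>G\<close> on \<open>X\<close>, the fixed-point set \<open>X\<^sub>g\<close> is \<open>invariants X \<phi> g\<close>, the stabilizer
  \<open>G\<^sub>x\<close> is \<open>stabilizer G \<phi> x\<close>, and \<open>X/G\<close> is \<open>orbits G X \<phi>\<close>.
\<close>

definition G_star :: "('g, 'm) monoid_scheme \<Rightarrow> 'x set \<Rightarrow> ('g \<Rightarrow> 'x \<Rightarrow> 'x) \<Rightarrow> 'g set"
  where "G_star G X \<phi> = {g \<in> carrier G. invariants X \<phi> g \<noteq> {}}"

definition dual_burnside ::
    "('g, 'm) monoid_scheme \<Rightarrow> 'x set \<Rightarrow> ('g \<Rightarrow> 'x \<Rightarrow> 'x) \<Rightarrow> 'g \<Rightarrow> 'g \<Rightarrow> real"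
  where "dual_burnside G X \<phi> g h =
    1 / real (card (invariants X \<phi> g)) *
      (\<Sum>x \<in> invariants X \<phi> g \<inter> invariants X \<phi> h. 1 / real (card (stabilizer G \<phi> x)))"

definition pi_Q :: "('g, 'm) monoid_scheme \<Rightarrow> 'x set \<Rightarrow> ('g \<Rightarrow> 'x \<Rightarrow> 'x) \<Rightarrow> 'g \<Rightarrow> real"
  where "pi_Q G X \<phi> g =
    real (card (invariants X \<phi> g)) / (real (order G) * real (card (orbits G X \<phi>)))"

lemma markov_kernel_dual_burnside:
  fixes G :: "('g, 'm) monoid_scheme"
  assumes "group_action G X \<phi>" and fG: "finite (carrier G)" and fX: "finite X"
  shows "markov_kernel (G_star G X \<phi>) (dual_burnside G X \<phi>)"
  unfolding markov_kernel_def prob_distribution_on_def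
proof (intro ballI conjI)
  interpret group_action G X \<phi> by fact
  let ?S = "G_star G X \<phi>"
  fix g assume g: "g \<in> ?S"
  show "0 \<le> dual_burnside G X \<phi> g h" for h
    unfolding dual_burnside_def by (intro mult_nonneg_nonneg sum_nonneg) auto
  have fS: "finite ?S" using fG by (simp add: G_star_def)
  let ?I = "invariants X \<phi>"
  have fI: "finite (?I h)" for h using fX by (simp add: invariants_def)
  have ne: "card (?I g) \<noteq> 0" using g fI by (simp add: G_star_def)
  have row: "(\<Sum>h\<in>?S. if x \<in> ?I h then 1 / real (card (stabilizer G \<phi> x)) else 0) = 1"
    if x: "x \<in> ?I g" for x
  proof -
    have xX: "x \<in> X" using x by (simp add: invariants_def)
    have eq: "{h \<in> ?S. x \<in> ?I h} = stabilizer G \<phi> x"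
      using xX by (auto simp: G_star_def invariants_def stabilizer_def)
    have "finite (stabilizer G \<phi> x)" using fG stabilizer_subset finite_subset by blast
    then have "card (stabilizer G \<phi> x) \<noteq> 0" using stabilizer_one_closed[OF xX] by auto
    then show ?thesis by (simp flip: sum.inter_filter add: fS eq)
  qed
  have "(\<Sum>h\<in>?S. dual_burnside G X \<phi> g h) = 1 / real (card (?I g)) *
      (\<Sum>h\<in>?S. \<Sum>x\<in>?I g. if x \<in> ?I h then 1 / real (card (stabilizer G \<phi> x)) else 0)"
    unfolding dual_burnside_def sum_distrib_left[symmetric]
    by (simp add: sum.inter_restrict[OF fI])
  also have "\<dots> = 1 / real (card (?I g)) *
      (\<Sum>x\<in>?I g. \<Sum>h\<in>?S. if x \<in> ?I h then 1 / real (card (stabilizer G \<phi> x)) else 0)"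
    by (subst sum.swap) simp
  also have "\<dots> = 1" using row ne by simp
  finally show "(\<Sum>h\<in>?S. dual_burnside G X \<phi> g h) = 1" .
qed

end

theory Submission
  imports Defs
begin

text \<open>
  The identity fixes every point, so every \<open>g\<close> moves to \<open>\<one>\<close> and \<open>\<one>\<close> moves to every \<open>h\<close> with positive
  probability; together with \<open>Q g g > 0\<close> this gives irreducibility and aperiodicity.  Detailed
  balance is the symmetry in \<open>g, h\<close> of \<open>|X\<^sub>g| Q g h\<close>, and Burnside's lemma normalises \<open>\<pi>\<^sub>Q\<close>.
  If \<open>\<mu>\<close> is stationary then reversibility makes \<open>\<mu> / \<pi>\<^sub>Q\<close> harmonic, hence constant by the maximum
  principle.
\<close>

lemma markov_kernelD:
  assumes "markov_kernel S Q" "g \<in> S"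
  shows "h \<in> S \<Longrightarrow> 0 \<le> Q g h" and "(\<Sum>h\<in>S. Q g h) = 1"
  using assms by (auto simp: markov_kernel_def prob_distribution_on_def)

lemma kernel_power_nonneg:
  assumes "markov_kernel S Q" "h \<in> S"
  shows "0 \<le> kernel_power S Q n g h"
  using assms(2)
  by (induction n arbitrary: h) (auto intro!: sum_nonneg mult_nonneg_nonneg markov_kernelD[OF assms(1)])

lemma kernel_power_1:
  assumes "finite S" "g \<in> S"
  shows "kernel_power S Q 1 g h = Q g h"
  using assms by (simp add: if_distrib[of "\<lambda>x. x * _"] cong: if_cong)

text \<open>Averaging with one step of \<open>Q\<close> leaves \<open>f\<close> fixed, so by
  induction averaging with \<open>n\<close> steps does too. For \<open>f = 1\<close> this says that
  the rows of the powers sum to 1.\<close>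

lemma kernel_power_harmonic:
  assumes "finite S" "g \<in> S"
    and harm: "\<And>g. g \<in> S \<Longrightarrow> (\<Sum>h\<in>S. Q g h * f h) = f g"
  shows "(\<Sum>h\<in>S. kernel_power S Q n g h * f h) = f g"
proof (induction n)
  case 0
  show ?case using assms by (simp add: if_distrib[of "\<lambda>x. x * _"] cong: if_cong)
next
  case (Suc n)
  have "(\<Sum>h\<in>S. kernel_power S Q (Suc n) g h * f h)
      = (\<Sum>k\<in>S. kernel_power S Q n g k * (\<Sum>h\<in>S. Q k h * f h))"
    unfolding kernel_power.simps sum_distrib_left sum_distrib_right mult.assoc by (rule sum.swap)
  also have "\<dots> = f g" using harm Suc by simp
  finally show ?case .
qed

text \<open>At a maximiser \<open>m\<close>, the value \<open>f m\<close> is an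
  \<open>n\<close>-step average of values at most \<open>f m\<close>, so \<open>f\<close> equals
  \<open>f m\<close> at every point charged by that average. Irreducibility supplies, for each
  \<open>k\<close>, an \<open>n\<close> that charges \<open>k\<close>.\<close>

lemma irreducible_harmonic_constant:
  assumes fin: "finite S" and mk: "markov_kernel S Q" and irr: "irreducible_kernel S Q"
    and harm: "\<And>g. g \<in> S \<Longrightarrow> (\<Sum>h\<in>S. Q g h * f h) = f g"
    and gh: "g \<in> S" "h \<in> S"
  shows "f g = f h"
proof -
  obtain m where m: "m \<in> S" "\<And>k. k \<in> S \<Longrightarrow> f k \<le> f m"
    using fin gh(1) Max_in[of "f ` S"] Max_ge[of "f ` S"] by fastforce
  have "f k = f m" if k: "k \<in> S" for k
  proof -
    obtain n where n: "kernel_power S Q n m k > 0"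
      using irr m(1) k unfolding irreducible_kernel_def by blast
    let ?P = "kernel_power S Q n m"
    \<comment> \<open>The constant function 1 is harmonic because the rows of \<open>Q\<close> sum
      to 1.\<close>
    have "(\<Sum>h\<in>S. ?P h * 1) = 1"
      using kernel_power_harmonic[OF fin m(1), of Q "\<lambda>_. 1"] markov_kernelD(2)[OF mk] by simp
    then have "(\<Sum>h\<in>S. ?P h * (f m - f h)) = 0"
      using kernel_power_harmonic[OF fin m(1) harm, of n]
      by (simp add: right_diff_distrib sum_subtractf flip: sum_distrib_right)
    \<comment> \<open>All summands are nonnegative, so each of them vanishes.\<close>
    then have "?P k * (f m - f k) = 0"
      using k m(2) kernel_power_nonneg[OF mk] by (subst (asm) sum_nonneg_eq_0_iff[OF fin]) auto
    with n show ?thesis by simp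
  qed
  with gh show ?thesis by simp
qed

lemma reversible_imp_stationary:
  assumes "markov_kernel S Q" "reversible S Q \<mu>"
  shows "stationary S Q \<mu>"
  unfolding stationary_def
proof
  fix h assume h: "h \<in> S"
  have "(\<Sum>g\<in>S. \<mu> g * Q g h) = (\<Sum>g\<in>S. \<mu> h * Q h g)"
    using assms(2) h by (intro sum.cong) (auto simp: reversible_def)
  also have "\<dots> = \<mu> h" using markov_kernelD(2)[OF assms(1) h] by (simp flip: sum_distrib_left)
  finally show "(\<Sum>g\<in>S. \<mu> g * Q g h) = \<mu> h" .
qed

lemma reversible_stationary_unique:
  assumes fin: "finite S" and mk: "markov_kernel S Q" and irr: "irreducible_kernel S Q"
    and rev: "reversible S Q \<pi>" and pos: "\<And>g. g \<in> S \<Longrightarrow> 0 < \<pi> g" and p: "prob_distribution_on S \<pi>"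
    and st: "stationary S Q \<mu>" and q: "prob_distribution_on S \<mu>" and g: "g \<in> S"
  shows "\<mu> g = \<pi> g"
proof -
  let ?f = "\<lambda>g. \<mu> g / \<pi> g"
  have harm: "(\<Sum>h\<in>S. Q k h * ?f h) = ?f k" if k: "k \<in> S" for k
  proof -
    \<comment> \<open>Detailed balance gives \<open>Q k h / \<pi> h = Q h k / \<pi> k\<close>, which
      turns the average of \<open>?f\<close> from \<open>k\<close> into the stationarity equation of
      \<open>\<mu>\<close> at \<open>k\<close>.\<close>
    have "Q k h * ?f h = \<mu> h * Q h k / \<pi> k" if h: "h \<in> S" for h
      using rev k h pos[OF k] pos[OF h] by (auto simp: reversible_def field_simps)
    then have "(\<Sum>h\<in>S. Q k h * ?f h) = (\<Sum>h\<in>S. \<mu> h * Q h k) / \<pi> k"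
      by (simp add: sum_divide_distrib)
    with st k show ?thesis by (simp add: stationary_def)
  qed
  have "\<mu> h = ?f g * \<pi> h" if "h \<in> S" for h
    using irreducible_harmonic_constant[OF fin mk irr harm g that] pos[OF that] by simp
  \<comment> \<open>Both total masses are 1, which fixes the constant ratio.\<close>
  then have "(\<Sum>h\<in>S. \<mu> h) = ?f g * (\<Sum>h\<in>S. \<pi> h)" by (simp add: sum_distrib_left)
  with p q have "?f g = 1" by (simp add: prob_distribution_on_def)
  with pos[OF g] show ?thesis by simp
qed

text \<open>A positive holding probability makes 1 a return time, and the gcd of the return times
  divides it.\<close>

lemma aperiodic_kernelI:
  assumes "finite S" "\<And>g. g \<in> S \<Longrightarrow> 0 < Q g g"
  shows "aperiodic_kernel S Q"
  unfolding aperiodic_kernel_def period_def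
proof
  fix g assume g: "g \<in> S"
  have "1 \<in> {n. n \<ge> 1 \<and> kernel_power S Q n g g > 0}"
    using assms(2)[OF g] kernel_power_1[OF assms(1) g] by auto
  then show "Gcd {n. n \<ge> 1 \<and> kernel_power S Q n g g > 0} = 1"
    by (metis Gcd_dvd nat_dvd_1_iff_1)
qed

context group_action
begin

lemma invariants_one: "invariants E \<phi> \<one> = E"
  by (auto simp: invariants_def simp flip: id_eq_one)

lemma one_in_G_star: "E \<noteq> {} \<Longrightarrow> \<one> \<in> G_star G E \<phi>"
  using group_hom by (simp add: G_star_def invariants_one group_hom_def group.is_monoid monoid.one_closed)

text \<open>A common fixed point \<open>x\<close> can be the intermediate sample of a move from
  \<open>g\<close> to \<open>h\<close>. Its stabilizer is finite and contains \<open>\<one>\<close>,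
  so \<open>x\<close> contributes a positive summand.\<close>

lemma dual_burnside_pos:
  assumes fin: "finite (carrier G)" "finite E"
    and ne: "invariants E \<phi> g \<inter> invariants E \<phi> h \<noteq> {}"
  shows "0 < dual_burnside G E \<phi> g h"
proof -
  have "finite (invariants E \<phi> g)" using fin by (simp add: invariants_def)
  moreover have "0 < card (stabilizer G \<phi> x)" if "x \<in> E" for x
    using stabilizer_one_closed[OF that] finite_subset[OF stabilizer_subset fin(1)]
    by (auto simp: card_gt_0_iff)
  ultimately show ?thesis
    using ne unfolding dual_burnside_def
    by (intro mult_pos_pos sum_pos) (auto simp: card_gt_0_iff invariants_def)
qed

lemma irreducible_dual_burnside:
  assumes fin: "finite (carrier G)" "finite E"
  shows "irreducible_kernel (G_star G E \<phi>) (dual_burnside G E \<phi>)"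
  unfolding irreducible_kernel_def
proof (intro ballI)
  let ?S = "G_star G E \<phi>" and ?Q = "dual_burnside G E \<phi>"
  fix g h assume g: "g \<in> ?S" and h: "h \<in> ?S"
  have finS: "finite ?S" using fin by (simp add: G_star_def)
  have mk: "markov_kernel ?S ?Q"
    by (intro markov_kernel_dual_burnside fin group_action_axioms)
  have "invariants E \<phi> k \<subseteq> E" for k by (auto simp: invariants_def)
  with g h have "0 < ?Q g \<one>" "0 < ?Q \<one> h"
    by (auto intro!: dual_burnside_pos fin simp: G_star_def invariants_one Int_absorb1 Int_absorb2)
  moreover have "\<one> \<in> ?S" using g by (intro one_in_G_star) (auto simp: G_star_def invariants_def)
  \<comment> \<open>The term \<open>k = \<one>\<close> is positive and the others are nonnegative,
    so two steps always suffice.\<close>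
  ultimately have "0 < (\<Sum>k\<in>?S. ?Q g k * ?Q k h)"
    using g h by (intro sum_pos2[OF finS]) (auto intro!: mult_nonneg_nonneg markov_kernelD(1)[OF mk])
  also have "\<dots> = kernel_power ?S ?Q 2 g h"
    using kernel_power_1[OF finS g] by (simp add: numeral_2_eq_2)
  finally show "\<exists>n\<ge>1. kernel_power ?S ?Q n g h > 0" by (intro exI[of _ 2]) simp
qed

lemma reversible_dual_burnside:
  "reversible S (dual_burnside G E \<phi>) (pi_Q G E \<phi>)" if "finite E" "S \<subseteq> G_star G E \<phi>"
proof -
  \<comment> \<open>This lets the prefactor of the kernel cancel against the numerator of
    \<open>pi_Q\<close>.\<close>
  have "card (invariants E \<phi> g) \<noteq> 0" if "g \<in> S" for g
    using that \<open>finite E\<close> \<open>S \<subseteq> _\<close> by (auto simp: G_star_def invariants_def)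
  then show ?thesis
    by (auto simp: reversible_def pi_Q_def dual_burnside_def Int_commute)
qed

lemma order_card_orbits_pos:
  assumes "finite (carrier G)" "finite E" "E \<noteq> {}"
  shows "0 < order G * card (orbits G E \<phi>)"
proof -
  \<comment> \<open>As an image of \<open>E\<close>, the set of orbits is visibly finite and
    nonempty.\<close>
  have "orbits G E \<phi> = orbit G \<phi> ` E" by (auto simp: orbits_def)
  moreover have "carrier G \<noteq> {}" using one_in_G_star[OF assms(3)] by (auto simp: G_star_def)
  ultimately show ?thesis using assms by (simp add: order_def card_gt_0_iff)
qed

lemma pi_Q_pos:
  assumes fin: "finite (carrier G)" "finite E" and g: "g \<in> G_star G E \<phi>"
  shows "0 < pi_Q G E \<phi> g"
proof -
  have "E \<noteq> {}" using g by (auto simp: G_star_def invariants_def)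
  moreover have "0 < card (invariants E \<phi> g)"
    using fin g by (simp add: G_star_def card_gt_0_iff invariants_def)
  ultimately show ?thesis
    using order_card_orbits_pos[OF fin] by (simp add: pi_Q_def)
qed

lemma prob_distribution_pi_Q:
  assumes fin: "finite (carrier G)" "finite E" and ne: "E \<noteq> {}"
  shows "prob_distribution_on (G_star G E \<phi>) (pi_Q G E \<phi>)"
proof -
  let ?S = "G_star G E \<phi>"
  \<comment> \<open>Burnside's lemma sums over the whole group; elements outside \<open>?S\<close>
    fix no point and contribute 0.\<close>
  have "(\<Sum>g\<in>?S. card (invariants E \<phi> g)) = card (orbits G E \<phi>) * order G"
    unfolding burnside[OF fin] by (rule sum.mono_neutral_left) (use fin in \<open>auto simp: G_star_def\<close>)
  then have "(\<Sum>g\<in>?S. real (card (invariants E \<phi> g))) = real (order G) * real (card (orbits G E \<phi>))"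
    by (simp flip: of_nat_sum)
  then have "(\<Sum>g\<in>?S. pi_Q G E \<phi> g) = 1"
    using order_card_orbits_pos[OF fin ne] unfolding pi_Q_def sum_divide_distrib[symmetric] by simp
  then show ?thesis using pi_Q_pos[OF fin] by (auto simp: prob_distribution_on_def less_imp_le)
qed

end

theorem theorem3p2:
  fixes G :: "('g, 'm) monoid_scheme" and X :: "'x set" and \<phi> :: "'g \<Rightarrow> 'x \<Rightarrow> 'x"
  assumes "group_action G X \<phi>"
    and "finite (carrier G)"
    and "finite X" and "X \<noteq> {}"
  shows "prob_distribution_on (G_star G X \<phi>) (pi_Q G X \<phi>)
    \<and> stationary (G_star G X \<phi>) (dual_burnside G X \<phi>) (pi_Q G X \<phi>)
    \<and> reversible (G_star G X \<phi>) (dual_burnside G X \<phi>) (pi_Q G X \<phi>)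
    \<and> irreducible_kernel (G_star G X \<phi>) (dual_burnside G X \<phi>)
    \<and> aperiodic_kernel (G_star G X \<phi>) (dual_burnside G X \<phi>)
    \<and> (\<forall>\<mu>. prob_distribution_on (G_star G X \<phi>) \<mu>
          \<and> stationary (G_star G X \<phi>) (dual_burnside G X \<phi>) \<mu>
        \<longrightarrow> (\<forall>g \<in> G_star G X \<phi>. \<mu> g = pi_Q G X \<phi> g))"
proof -
  interpret group_action G X \<phi> by fact
  let ?S = "G_star G X \<phi>" and ?Q = "dual_burnside G X \<phi>" and ?\<pi> = "pi_Q G X \<phi>"
  have finS: "finite ?S" using assms(2) by (simp add: G_star_def)
  have mk: "markov_kernel ?S ?Q" by (rule markov_kernel_dual_burnside[OF assms(1-3)])
  have prob: "prob_distribution_on ?S ?\<pi>" by (rule prob_distribution_pi_Q[OF assms(2-4)])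
  have rev: "reversible ?S ?Q ?\<pi>" by (rule reversible_dual_burnside[OF assms(3) order_refl])
  have irr: "irreducible_kernel ?S ?Q" by (rule irreducible_dual_burnside[OF assms(2,3)])
  \<comment> \<open>Each \<open>g\<close> in \<open>?S\<close> shares its own fixed points with
    itself, so it stays put with positive probability.\<close>
  have "aperiodic_kernel ?S ?Q"
    using dual_burnside_pos[OF assms(2,3)] by (intro aperiodic_kernelI[OF finS]) (simp add: G_star_def)
  moreover have "\<forall>g\<in>?S. \<mu> g = ?\<pi> g" if "prob_distribution_on ?S \<mu>" "stationary ?S ?Q \<mu>" for \<mu>
    using reversible_stationary_unique[OF finS mk irr rev pi_Q_pos[OF assms(2,3)] prob that(2,1)] by blast
  ultimately show ?thesis using prob rev irr reversible_imp_stationary[OF mk rev] by blast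
qed

end
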